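(* Let $\{\Gamma_k\}_{k=1}^K$ be a clustering of the $n$ data points $\mathcal X=\{x^i\}_{i=1}^n$ (i.e., a partition of $[n]$ into $K$ nonempty subsets), with associated partition matrix $X = \sum_{k=1}^K \frac{1}{|\Gamma_k|}\mathbf{1}_{\Gamma_k}\mathbf{1}_{\Gamma_k}^T$. Let $\mathcal G$ be the set of protected groups, and let $\tau_g\in(0,\frac1K]$ for $g\in\mathcal G$. Then the clustering satisfies $$\frac{|\Gamma_k \cap \mathcal X_g|}{|\mathcal X_g|} \geq \tau_g, \quad \forall g \in \mathcal G, \; \forall k \in [K],$$ if and only if $X$ satisfies the linear inequalities $$\sum_{i = 1}^{n} X_{ij}\,\eta^g_{i} \geq \tau_g\, |\mathcal X_g|\, X_{jj}, \quad \forall g\in \mathcal G,\; \forall j\in [n].$$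
   Context: Here $[n]=\{1,\dots,n\}$ and $\mathcal X=\{x^i\}_{i=1}^n$ is a set of $n$ data points in $\mathbb R^m$, identified with their indices in $[n]$. A partition of $[n]$ is a family $\{\Gamma_k\}_{k=1}^K$ of nonempty, pairwise disjoint subsets of $[n]$ whose union is $[n]$. The vector $\mathbf 1_{\Gamma_k}\in\{0,1\}^n$ is the indicator vector of $\Gamma_k$. Each point has a protected attribute $g\in\mathcal G$, where $\mathcal G$ is the finite set of protected groups; $\mathcal X_g\subseteq\mathcal X$ is the (nonempty) set of points with protected attribute $g$, $|\mathcal X_g|$ is the number of such points, and $|\Gamma_k\cap\mathcal X_g|$ denotes the number of indices $i\in\Gamma_k$ with $x^i\in\mathcal X_g$. The vector $\eta^g\in\{0,1\}^n$ is the indicator vector of group $g$: $\eta^g_i=1$ if $x^i\in\mathcal X_g$ and $\eta^g_i=0$ otherwise. *)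

theory Defs
  imports "HOL-Analysis.Analysis"
begin

text \<open>The index set $[n]$ is a finite type \<open>'n\<close> with $n$ elements.\<close>

definition is_clustering :: "nat \<Rightarrow> (nat \<Rightarrow> 'n::finite set) \<Rightarrow> bool" where
  "is_clustering K \<Gamma> \<longleftrightarrow>
     (\<forall>k\<in>{1..K}. \<Gamma> k \<noteq> {}) \<and> disjoint_family_on \<Gamma> {1..K} \<and> (\<Union>k\<in>{1..K}. \<Gamma> k) = UNIV"

definition indicator_vec :: "'n::finite set \<Rightarrow> real ^ 'n" where
  "indicator_vec S = (\<chi> i. indicator S i)"

definition outer :: "real ^ 'n \<Rightarrow> real ^ 'n \<Rightarrow> real ^ 'n ^ 'n" where
  "outer u v = (columnvector u :: real ^ 1 ^ 'n) ** (rowvector v :: real ^ 'n ^ 1)"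

definition partition_matrix :: "nat \<Rightarrow> (nat \<Rightarrow> 'n::finite set) \<Rightarrow> real ^ 'n ^ 'n" where
  "partition_matrix K \<Gamma> =
     (\<Sum>k\<in>{1..K}. (1 / real (card (\<Gamma> k))) *\<^sub>R outer (indicator_vec (\<Gamma> k)) (indicator_vec (\<Gamma> k)))"

text \<open>For data points \<open>x\<close> and a set \<open>A\<close> of points, the indices of the points lying in \<open>A\<close>;
  this realises the identification of points with their indices.\<close>

definition indices_of :: "('n::finite \<Rightarrow> real ^ 'm) \<Rightarrow> (real ^ 'm) set \<Rightarrow> 'n set" where
  "indices_of x A = {i. x i \<in> A}"

text \<open>\<open>Xg g\<close> is the set of data points with protected attribute \<open>g\<close>. Every point has some
  attribute; groups are not required to be disjoint.\<close>

definition protected_groups ::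
  "('n::finite \<Rightarrow> real ^ 'm) \<Rightarrow> 'g set \<Rightarrow> ('g \<Rightarrow> (real ^ 'm) set) \<Rightarrow> bool" where
  "protected_groups x G Xg \<longleftrightarrow> finite G
     \<and> (\<forall>g\<in>G. Xg g \<subseteq> range x \<and> Xg g \<noteq> {})
     \<and> (\<forall>p\<in>range x. \<exists>g\<in>G. p \<in> Xg g)"

definition group_vec :: "('n::finite \<Rightarrow> real ^ 'm) \<Rightarrow> ('g \<Rightarrow> (real ^ 'm) set) \<Rightarrow> 'g \<Rightarrow> real ^ 'n" where
  "group_vec x Xg g = (\<chi> i. if x i \<in> Xg g then 1 else 0)"

end

theory Submission
  imports Defs
begin

text \<open>Fix a point j and the cluster \<Gamma> k containing it. Column j of X is the indicator
  of \<Gamma> k scaled by 1/|\<Gamma> k| (\<open>partition_matrix_nth\<close>), so its diagonal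
  entry is 1/|\<Gamma> k| and its product with the group vector is the number of group members in
  \<Gamma> k divided by |\<Gamma> k| (\<open>sum_partition_matrix_group_vec\<close>). Cancelling
  1/|\<Gamma> k| and dividing by the size of the group turns the linear inequality for (g, j) into
  the fairness inequality for (g, k). As the clusters are nonempty and cover all points, ranging
  over j amounts to ranging over k.\<close>

lemma outer_nth: "outer u v $ i $ j = u $ i * v $ j"
  by (simp add: outer_def matrix_matrix_mult_def columnvector_def rowvector_def)

text \<open>By disjointness, j lies in no other cluster, so only the k-th rank-one term contributes
  to column j.\<close>

lemma partition_matrix_nth:
  assumes "is_clustering K \<Gamma>" and "k \<in> {1..K}" and "j \<in> \<Gamma> k"
  shows "partition_matrix K \<Gamma> $ i $ j = indicator (\<Gamma> k) i / real (card (\<Gamma> k))"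
proof -
  have other: "j \<notin> \<Gamma> l" if "l \<in> {1..K}" "l \<noteq> k" for l
    using assms that unfolding is_clustering_def disjoint_family_on_def by blast
  have "partition_matrix K \<Gamma> $ i $ j =
      (\<Sum>l\<in>{1..K}. indicator (\<Gamma> l) i * indicator (\<Gamma> l) j / real (card (\<Gamma> l)))"
    by (simp add: partition_matrix_def outer_nth indicator_vec_def)
  also have "\<dots> = (\<Sum>l\<in>{1..K}. if l = k then indicator (\<Gamma> k) i / real (card (\<Gamma> k)) else 0)"
    using assms(3) other by (intro sum.cong) auto
  also have "\<dots> = indicator (\<Gamma> k) i / real (card (\<Gamma> k))"
    using assms(2) by simp
  finally show ?thesis .
qed

text \<open>The product of the two 0/1 vectors is the indicator of the intersection, and summing it
  counts elements.\<close>

lemma sum_partition_matrix_group_vec: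
  assumes "is_clustering K \<Gamma>" and "k \<in> {1..K}" and "j \<in> \<Gamma> k"
  shows "(\<Sum>i\<in>UNIV. partition_matrix K \<Gamma> $ i $ j * group_vec x Xg g $ i)
    = real (card (\<Gamma> k \<inter> indices_of x (Xg g))) / real (card (\<Gamma> k))"
proof -
  have "(\<Sum>i\<in>UNIV. partition_matrix K \<Gamma> $ i $ j * group_vec x Xg g $ i)
      = (\<Sum>i\<in>UNIV. indicator (\<Gamma> k \<inter> indices_of x (Xg g)) i / real (card (\<Gamma> k)))"
    unfolding partition_matrix_nth[OF assms]
    by (intro sum.cong) (auto simp: group_vec_def indices_of_def indicator_def)
  then show ?thesis
    by (simp add: sum_divide_distrib[symmetric] indicator_def sum.If_cases Int_def)
qed

theorem proposition2:
  fixes x :: "'n::finite \<Rightarrow> real ^ 'm"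
    and K :: nat and \<Gamma> :: "nat \<Rightarrow> 'n set"
    and G :: "'g set" and Xg :: "'g \<Rightarrow> (real ^ 'm) set" and \<tau> :: "'g \<Rightarrow> real"
    and X :: "real ^ 'n ^ 'n"
  assumes "inj x"
    and "is_clustering K \<Gamma>"
    and "X = partition_matrix K \<Gamma>"
    and "protected_groups x G Xg"
    and "\<And>g. g \<in> G \<Longrightarrow> 0 < \<tau> g \<and> \<tau> g \<le> 1 / real K"
  shows "(\<forall>g\<in>G. \<forall>k\<in>{1..K}.
            real (card (\<Gamma> k \<inter> indices_of x (Xg g))) / real (card (Xg g)) \<ge> \<tau> g)
     \<longleftrightarrow> (\<forall>g\<in>G. \<forall>j. (\<Sum>i\<in>UNIV. X $ i $ j * group_vec x Xg g $ i)
            \<ge> \<tau> g * real (card (Xg g)) * X $ j $ j)"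
proof -
  have column_iff:
    "(\<Sum>i\<in>UNIV. X $ i $ j * group_vec x Xg g $ i) \<ge> \<tau> g * real (card (Xg g)) * X $ j $ j
      \<longleftrightarrow> real (card (\<Gamma> k \<inter> indices_of x (Xg g))) / real (card (Xg g)) \<ge> \<tau> g"
    if g: "g \<in> G" and k: "k \<in> {1..K}" and j: "j \<in> \<Gamma> k" for g k j
  proof -
    \<comment> \<open>The group lies in the finite range of \<open>x\<close>; this rules out the
      default value 0 of \<open>card\<close> on infinite sets, so the division by
      \<open>card (Xg g)\<close> is genuine.\<close>
    have "finite (Xg g)" "Xg g \<noteq> {}"
      using assms(4) g finite_subset[of "Xg g" "range x"] by (auto simp: protected_groups_def)
    then have "real (card (Xg g)) > 0" by (simp add: card_gt_0_iff)
    moreover have "real (card (\<Gamma> k)) > 0" using j by (auto simp: card_gt_0_iff)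
    moreover have "X $ j $ j = 1 / real (card (\<Gamma> k))"
      using partition_matrix_nth[OF assms(2) k j] assms(3) j by simp
    ultimately show ?thesis
      unfolding assms(3) sum_partition_matrix_group_vec[OF assms(2) k j]
      by (simp add: divide_le_cancel pos_le_divide_eq)
  qed
  \<comment> \<open>Covering gives each j a cluster, for the forward direction; nonemptiness gives
    each cluster a representative j, for the converse.\<close>
  have "\<exists>k\<in>{1..K}. j \<in> \<Gamma> k" for j
    using assms(2) unfolding is_clustering_def by blast
  moreover have "\<exists>j. j \<in> \<Gamma> k" if "k \<in> {1..K}" for k
    using assms(2) that unfolding is_clustering_def by blast
  ultimately show ?thesis
    using column_iff by meson
qed

end
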